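(* Let $m,n$ be positive integers, $a,b$ non-negative integers with $a+b=n$ and $a$ even, and $x,y$ complex numbers with $ax+by=0$. Define \[ R_{2,3}(x,y;m,n;\tau)= mn\, q^{\frac{a}{4}}\sum_{\substack{r_1,\ldots,r_a,s_1,\ldots,s_b\in\mathbb{Z}\\ 2(r_1+\cdots+r_a+s_1+\cdots+s_b)+a=0}}q^{r_1^2+\cdots+r_a^2+s_1^2+\cdots+s_b^2+r_1+\cdots+r_a}e^{i(2(r_1+\cdots+r_a)x+2(s_1+\cdots+s_b)y+ax)}. \] Then for all $z\in\mathbb{C}$, \[ \sum_{k=0}^{mn-1}\vartheta_2^{a}\!\left(z+x+\tfrac{k\pi}{mn}\Big|\tau\right)\vartheta_3^{b}\!\left(z+y+\tfrac{k\pi}{mn}\Big|\tau\right)=R_{2,3}(x,y;m,n;\tau)\,\vartheta_3(mnz\,|\,m^2n\tau). \]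
   Context: Throughout, $\tau\in\mathbb{C}$ with $\Im(\tau)>0$, $q=e^{\pi i\tau}$, and $q^{\alpha}$ means $e^{\pi i\alpha\tau}$ for real $\alpha$. The Jacobi theta functions are $\vartheta_2(z|\tau)=q^{1/4}\sum_{n\in\mathbb{Z}}q^{n(n+1)}e^{(2n+1)iz}$ and $\vartheta_3(z|\tau)=\sum_{n\in\mathbb{Z}}q^{n^2}e^{2niz}$; $\vartheta_3(z|m^2n\tau)$ denotes $\vartheta_3$ with $\tau$ replaced by $m^2n\tau$. A zeroth power equals $1$. *)

theory Defs
  imports "HOL-Analysis.Analysis"
begin

text \<open>\<^term>\<open>qpow \<tau> \<alpha>\<close> is $q^\alpha$ for the nome $q = e^{\pi i \tau}$; the branch is fixed by $\tau$,
  so this is not a power function of the number $q$.\<close>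

definition qpow :: "complex \<Rightarrow> real \<Rightarrow> complex" where
  "qpow \<tau> \<alpha> = exp (of_real pi * \<i> * of_real \<alpha> * \<tau>)"

text \<open>All series below converge absolutely for $\Im \tau > 0$, so the unordered sum
  \<^const>\<open>infsum\<close> is the intended value.\<close>

definition jacobi_theta2 :: "complex \<Rightarrow> complex \<Rightarrow> complex" where
  "jacobi_theta2 z \<tau> = qpow \<tau> (1/4) *
     (\<Sum>\<^sub>\<infinity>n\<in>(UNIV::int set). qpow \<tau> (of_int (n * (n + 1))) * exp (of_int (2 * n + 1) * \<i> * z))"

definition jacobi_theta3 :: "complex \<Rightarrow> complex \<Rightarrow> complex" where
  "jacobi_theta3 z \<tau> =
     (\<Sum>\<^sub>\<infinity>n\<in>(UNIV::int set). qpow \<tau> (of_int (n\<^sup>2)) * exp (of_int (2 * n) * \<i> * z))"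

text \<open>Integer tuples $(r_1,\ldots,r_a)$ and $(s_1,\ldots,s_b)$ are extensional functions, so that
  each tuple is counted exactly once.\<close>

definition R23_index :: "nat \<Rightarrow> nat \<Rightarrow> ((nat \<Rightarrow> int) \<times> (nat \<Rightarrow> int)) set" where
  "R23_index a b =
     {(r, s). r \<in> {1..a} \<rightarrow>\<^sub>E UNIV \<and> s \<in> {1..b} \<rightarrow>\<^sub>E UNIV \<and>
        2 * ((\<Sum>i=1..a. r i) + (\<Sum>j=1..b. s j)) + int a = 0}"

definition R23 :: "nat \<Rightarrow> nat \<Rightarrow> complex \<Rightarrow> complex \<Rightarrow> nat \<Rightarrow> nat \<Rightarrow> complex \<Rightarrow> complex" where
  "R23 a b x y m n \<tau> = of_nat (m * n) * qpow \<tau> (real a / 4) *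
     (\<Sum>\<^sub>\<infinity>(r, s)\<in>R23_index a b.
        qpow \<tau> (of_int ((\<Sum>i=1..a. (r i)\<^sup>2) + (\<Sum>j=1..b. (s j)\<^sup>2) + (\<Sum>i=1..a. r i))) *
        exp (\<i> * (2 * of_int (\<Sum>i=1..a. r i) * x + 2 * of_int (\<Sum>j=1..b. s j) * y + of_nat a * x)))"

end

theory Submission imports Defs begin

text \<open>Expanding the powers of theta functions into a single multiple series, a term with index
  $(r, s)$ depends on $k$ only through $e^{2 \pi i k N / (mn)}$ with $N = \sum r + \sum s + a/2$, so
  summing over $k$ keeps exactly the terms with $N = mnl$. Translating all $n$ indices by $ml$
  reduces these to $N = 0$: since $N = 0$ and $ax + by = 0$, all cross terms vanish and the
  translation only produces the factor $q^{m^2 n l^2} e^{2 i m n l z}$, which sums to the theta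
  function on the right.\<close>

no_notation Infinite_Set_Sum.abs_summable_on (infix "abs'_summable'_on" 50)

section \<open>Products and finite sums of unordered sums\<close>

lemma abs_summable_on_Times:
  fixes f :: "'a \<Rightarrow> 'c :: {banach, real_normed_field}"
  assumes "f abs_summable_on A" and "g abs_summable_on B"
  shows "(\<lambda>(x, y). f x * g y) abs_summable_on A \<times> B"
  using assms
  by (subst Infinite_Sum.abs_summable_on_Sigma_iff)
     (auto simp: norm_mult infsum_cmult_right' abs_mult intro: summable_on_cmult_right summable_on_cmult_left)

text \<open>Fubini over the joint family, after which constant factors leave each inner sum. The
  hypothesis concerns the joint family because that is what reindexing by translations supplies at
  the end.\<close>

lemma infsum_Times:
  fixes f :: "'a \<Rightarrow> 'c :: {banach, real_normed_field}"
  assumes "(\<lambda>(x, y). f x * g y) summable_on A \<times> B"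
  shows "(\<Sum>\<^sub>\<infinity>(x, y)\<in>A \<times> B. f x * g y) = infsum f A * infsum g B"
  using infsum_Sigma_banach[OF assms]
  by (simp add: infsum_cmult_right' infsum_cmult_left')

lemma has_sum_sum:
  fixes f :: "'i \<Rightarrow> 'a \<Rightarrow> 'c :: {topological_comm_monoid_add, t2_space}"
  assumes "finite I" and "\<And>i. i \<in> I \<Longrightarrow> (f i has_sum S i) A"
  shows "((\<lambda>x. \<Sum>i\<in>I. f i x) has_sum (\<Sum>i\<in>I. S i)) A"
  using assms by (induction I rule: finite_induct) (auto intro: has_sum_add)

section \<open>Absolute convergence of the theta series\<close>

text \<open>A majorant for theta series: one geometric series on each half-line of the
  integers.\<close>

lemma summable_on_exp_minus_abs_int:
  "(\<lambda>k::int. exp (- real_of_int \<bar>k\<bar>)) summable_on UNIV"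
proof -
  let ?f = "\<lambda>k::int. exp (- real_of_int \<bar>k\<bar>)"
  have "summable (\<lambda>n. exp (- 1 :: real) ^ n)"
    by (rule summable_geometric) simp
  then have nat: "(\<lambda>n. exp (- real n)) summable_on UNIV"
    by (intro norm_summable_imp_summable_on) (simp flip: exp_of_nat_mult)
  have "?f summable_on range int" "?f summable_on range (\<lambda>n. - int n)"
    using nat by (subst summable_on_reindex; simp add: inj_on_def o_def)+
  then have "?f summable_on (range int \<union> range (\<lambda>n. - int n))"
    by (rule summable_on_union)
  also have "range int \<union> range (\<lambda>n. - int n) = UNIV"
  proof -
    have "k \<in> range int \<union> range (\<lambda>n. - int n)" for k
      by (cases k rule: int_cases2) auto
    then show ?thesis by blast
  qed
  finally show ?thesis .
qed

text \<open>The terms have norm \<open>exp (- d * k^2 - 2 * k * Im z)\<close> with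
  \<open>d = pi * Im \<tau> > 0\<close>, so the Gaussian decay beats the linear growth.\<close>

lemma theta3_terms_abs_summable:
  assumes "Im \<tau> > 0"
  shows "(\<lambda>k::int. qpow \<tau> (of_int (k\<^sup>2)) * exp (of_int (2 * k) * \<i> * z)) abs_summable_on UNIV"
proof (rule Infinite_Sum.abs_summable_on_comparison_test')
  \<comment> \<open>The growth rate is at most \<open>2 * \<bar>Im z\<bar>\<close>; the extra 1
    leaves a factor \<open>exp (- \<bar>k\<bar>)\<close> over.\<close>
  define c where "c = 2 * \<bar>Im z\<bar> + 1"
  define d where "d = pi * Im \<tau>"
  have d: "d > 0" using assms by (simp add: d_def)
  show "(\<lambda>k::int. exp (c\<^sup>2 / (4 * d)) * exp (- real_of_int \<bar>k\<bar>)) summable_on UNIV"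
    by (intro summable_on_cmult_right summable_on_exp_minus_abs_int)
  fix k :: int
  \<comment> \<open>Completing the square bounds the exponent by a constant independent of
    \<open>k\<close>.\<close>
  have "0 \<le> (2 * d * \<bar>k\<bar> - c)\<^sup>2 / (4 * d)" using d by simp
  also have "\<dots> = d * (of_int k)\<^sup>2 - c * \<bar>k\<bar> + c\<^sup>2 / (4 * d)"
    using d by (simp add: field_simps power2_eq_square)
  finally have *: "c * \<bar>k\<bar> - d * (of_int k)\<^sup>2 \<le> c\<^sup>2 / (4 * d)" by simp
  have "- (2 * real_of_int k * Im z) \<le> 2 * (\<bar>real_of_int k\<bar> * \<bar>Im z\<bar>)"
    using abs_ge_minus_self[of "real_of_int k * Im z"] by (simp add: abs_mult mult_ac)
  then have "- (d * (of_int k)\<^sup>2) - 2 * of_int k * Im z \<le> c\<^sup>2 / (4 * d) - \<bar>k\<bar>"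
    using * by (simp add: c_def algebra_simps)
  then show "norm (qpow \<tau> (of_int (k\<^sup>2)) * exp (of_int (2 * k) * \<i> * z))
      \<le> exp (c\<^sup>2 / (4 * d)) * exp (- real_of_int \<bar>k\<bar>)"
    by (simp add: qpow_def norm_mult d_def mult_ac flip: exp_add)
qed

text \<open>Since \<open>k * (k + 1) = k^2 + k\<close>, these are the terms of theta 3 at the point
  moved by half a quasi-period, \<open>pi * \<tau> / 2\<close>, times
  \<open>exp (\<i> * z)\<close>.\<close>

lemma theta2_terms_abs_summable:
  assumes "Im \<tau> > 0"
  shows "(\<lambda>k::int. qpow \<tau> (of_int (k * (k + 1))) * exp (of_int (2 * k + 1) * \<i> * z))
    abs_summable_on UNIV"
proof -
  have "(\<lambda>k::int. exp (\<i> * z) * (qpow \<tau> (of_int (k\<^sup>2)) *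
      exp (of_int (2 * k) * \<i> * (z + of_real pi * \<tau> / 2)))) abs_summable_on UNIV"
    using theta3_terms_abs_summable[OF assms] by (simp only: norm_mult summable_on_cmult_right)
  also have "(\<lambda>k::int. exp (\<i> * z) * (qpow \<tau> (of_int (k\<^sup>2)) *
      exp (of_int (2 * k) * \<i> * (z + of_real pi * \<tau> / 2)))) =
      (\<lambda>k::int. qpow \<tau> (of_int (k * (k + 1))) * exp (of_int (2 * k + 1) * \<i> * z))"
    by (simp add: fun_eq_iff qpow_def algebra_simps power2_eq_square flip: exp_add)
  finally show ?thesis .
qed

section \<open>Powers of theta functions as multiple series\<close>

text \<open>Distributing a product of \<open>a\<close> absolutely convergent series gives a sum over
  tuples; \<open>F\<close> merges each product of terms into one exponential. For
  \<open>a = 0\<close> there is exactly one extensional tuple, and it contributes 1.\<close>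

lemma jacobi_theta2_power:
  fixes \<tau> :: complex and a :: nat
  assumes "Im \<tau> > 0"
  defines "F \<equiv> \<lambda>w r. exp (of_real pi * \<i> * \<tau> * (of_nat a / 4 + of_int ((\<Sum>i=1..a. (r i)\<^sup>2) + (\<Sum>i=1..a. r i)))
      + (2 * of_int (\<Sum>i=1..a. r i) + of_nat a) * \<i> * w)"
  shows "jacobi_theta2 w \<tau> ^ a = (\<Sum>\<^sub>\<infinity>r\<in>{1..a} \<rightarrow>\<^sub>E UNIV. F w r)"
    and "F w abs_summable_on ({1..a} \<rightarrow>\<^sub>E UNIV)"
proof -
  \<comment> \<open>The prefactor goes into each term, so that \<open>a\<close> factors produce the
    \<open>a / 4\<close> in \<open>F\<close>.\<close>
  define f where "f = (\<lambda>k::int. qpow \<tau> (1/4) *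
    (qpow \<tau> (of_int (k * (k + 1))) * exp (of_int (2 * k + 1) * \<i> * w)))"
  have f: "f abs_summable_on UNIV"
    using theta2_terms_abs_summable[OF assms(1)]
    unfolding f_def by (simp only: norm_mult summable_on_cmult_right)
  have F: "F w = (\<lambda>r. \<Prod>i=1..a. f (r i))"
  proof
    fix r :: "nat \<Rightarrow> int"
    have "f k = exp (of_real pi * \<i> * \<tau> * (1 / 4 + (of_int (k\<^sup>2) + of_int k)) + (2 * of_int k + 1) * (\<i> * w))" for k
      by (simp add: f_def qpow_def algebra_simps power2_eq_square flip: exp_add)
    then have "(\<Prod>i=1..a. f (r i)) = exp (\<Sum>i=1..a. of_real pi * \<i> * \<tau> * (1 / 4 + (of_int ((r i)\<^sup>2) + of_int (r i)))
        + (2 * of_int (r i) + 1) * (\<i> * w))"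
      by (simp only: exp_sum finite_atLeastAtMost)
    then show "F w r = (\<Prod>i=1..a. f (r i))"
      by (simp add: F_def sum.distrib mult.assoc flip: sum_distrib_left sum_distrib_right)
  qed
  have "jacobi_theta2 w \<tau> = infsum f UNIV"
    by (simp add: jacobi_theta2_def f_def infsum_cmult_right')
  then show "jacobi_theta2 w \<tau> ^ a = (\<Sum>\<^sub>\<infinity>r\<in>{1..a} \<rightarrow>\<^sub>E UNIV. F w r)"
    unfolding F using f by (subst infsum_prod_PiE_abs) auto
  show "F w abs_summable_on ({1..a} \<rightarrow>\<^sub>E UNIV)"
    \<comment> \<open>The product rule over \<open>PiE\<close> is stated for the notion of absolute
      summability from \<open>Infinite_Set_Sum\<close>, hence the translation in both
      directions.\<close>
    unfolding F abs_summable_equivalent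
    using f[unfolded abs_summable_equivalent] by (intro abs_summable_on_prod_PiE) auto
qed

lemma jacobi_theta3_power:
  fixes \<tau> :: complex and b :: nat
  assumes "Im \<tau> > 0"
  defines "F \<equiv> \<lambda>w s. exp (of_real pi * \<i> * \<tau> * of_int (\<Sum>j=1..b. (s j)\<^sup>2)
      + 2 * of_int (\<Sum>j=1..b. s j) * \<i> * w)"
  shows "jacobi_theta3 w \<tau> ^ b = (\<Sum>\<^sub>\<infinity>s\<in>{1..b} \<rightarrow>\<^sub>E UNIV. F w s)"
    and "F w abs_summable_on ({1..b} \<rightarrow>\<^sub>E UNIV)"
proof -
  define f where "f = (\<lambda>k::int. qpow \<tau> (of_int (k\<^sup>2)) * exp (of_int (2 * k) * \<i> * w))"
  have f: "f abs_summable_on UNIV"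
    using theta3_terms_abs_summable[OF assms(1)] unfolding f_def .
  have F: "F w = (\<lambda>s. \<Prod>j=1..b. f (s j))"
  proof
    fix s :: "nat \<Rightarrow> int"
    have "f k = exp (of_real pi * \<i> * \<tau> * of_int (k\<^sup>2) + 2 * of_int k * (\<i> * w))" for k
      by (simp add: f_def qpow_def algebra_simps flip: exp_add)
    then have "(\<Prod>j=1..b. f (s j)) =
        exp (\<Sum>j=1..b. of_real pi * \<i> * \<tau> * of_int ((s j)\<^sup>2) + 2 * of_int (s j) * (\<i> * w))"
      by (simp only: exp_sum finite_atLeastAtMost)
    then show "F w s = (\<Prod>j=1..b. f (s j))"
      by (simp add: F_def sum.distrib mult.assoc flip: sum_distrib_left sum_distrib_right)
  qed
  have "jacobi_theta3 w \<tau> = infsum f UNIV"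
    by (simp add: jacobi_theta3_def f_def)
  then show "jacobi_theta3 w \<tau> ^ b = (\<Sum>\<^sub>\<infinity>s\<in>{1..b} \<rightarrow>\<^sub>E UNIV. F w s)"
    unfolding F using f by (subst infsum_prod_PiE_abs) auto
  show "F w abs_summable_on ({1..b} \<rightarrow>\<^sub>E UNIV)"
    unfolding F abs_summable_equivalent
    using f[unfolded abs_summable_equivalent] by (intro abs_summable_on_prod_PiE) auto
qed

section \<open>Orthogonality of roots of unity\<close>

lemma sum_roots_of_unity_powers:
  fixes N :: int
  assumes "M > 0"
  shows "(\<Sum>k<M. exp (2 * of_int N * \<i> * (of_nat k * of_real pi / of_nat M))) =
    (if int M dvd N then of_nat M else 0)"
proof -
  define \<omega> where "\<omega> = exp (2 * of_int N * \<i> * of_real pi / of_nat M)"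
  have pow: "exp (2 * of_int N * \<i> * (of_nat k * of_real pi / of_nat M)) = \<omega> ^ k" for k
    by (simp add: \<omega>_def mult_ac flip: exp_of_nat_mult)
  have one: "\<omega> ^ M = 1"
    using assms by (simp add: exp_eq_1 \<omega>_def flip: exp_of_nat_mult)
  have "\<omega> = 1 \<longleftrightarrow> (\<exists>l::int. real_of_int N = of_int l * of_nat M)"
    using assms by (auto simp: \<omega>_def exp_eq_1 field_simps)
  also have "\<dots> \<longleftrightarrow> (\<exists>l::int. N = l * int M)"
    by (metis of_int_eq_iff of_int_mult of_int_of_nat_eq)
  also have "\<dots> \<longleftrightarrow> int M dvd N"
    by (auto simp: dvd_def mult.commute)
  finally have "\<omega> = 1 \<longleftrightarrow> int M dvd N" .
  then show ?thesis
    \<comment> \<open>If \<open>\<omega> = 1\<close>, all \<open>M\<close> summands are 1; otherwise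
      the geometric sum has numerator \<open>\<omega> ^ M - 1 = 0\<close>.\<close>
    unfolding pow using one geometric_sum[of \<omega> M] by auto
qed

section \<open>Index tuples, their weights and translations\<close>

definition theta_index :: "nat \<Rightarrow> nat \<Rightarrow> ((nat \<Rightarrow> int) \<times> (nat \<Rightarrow> int)) set" where
  "theta_index a b = ({1..a} \<rightarrow>\<^sub>E UNIV) \<times> ({1..b} \<rightarrow>\<^sub>E UNIV)"

text \<open>For even \<open>a\<close> this is half of the expression constrained in
  \<open>R23_index\<close>, and it is the frequency of a term: moving both arguments by
  \<open>w\<close> multiplies the term by \<open>exp (2 * N * \<i> * w)\<close>, with
  \<open>N\<close> the weight.\<close>

definition index_weight :: "nat \<Rightarrow> nat \<Rightarrow> (nat \<Rightarrow> int) \<times> (nat \<Rightarrow> int) \<Rightarrow> int" where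
  "index_weight a b = (\<lambda>(r, s). (\<Sum>i=1..a. r i) + (\<Sum>j=1..b. s j) + int (a div 2))"

definition R23_term :: "nat \<Rightarrow> nat \<Rightarrow> complex \<Rightarrow> complex \<Rightarrow> complex \<Rightarrow> (nat \<Rightarrow> int) \<times> (nat \<Rightarrow> int) \<Rightarrow> complex" where
  "R23_term a b x y \<tau> = (\<lambda>(r, s).
     qpow \<tau> (of_int ((\<Sum>i=1..a. (r i)\<^sup>2) + (\<Sum>j=1..b. (s j)\<^sup>2) + (\<Sum>i=1..a. r i))) *
     exp (\<i> * (2 * of_int (\<Sum>i=1..a. r i) * x + 2 * of_int (\<Sum>j=1..b. s j) * y + of_nat a * x)))"

text \<open>The restricted abstractions keep the translated tuples extensional.\<close>

definition index_shift :: "nat \<Rightarrow> nat \<Rightarrow> int \<Rightarrow> (nat \<Rightarrow> int) \<times> (nat \<Rightarrow> int) \<Rightarrow> (nat \<Rightarrow> int) \<times> (nat \<Rightarrow> int)" where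
  "index_shift a b t = (\<lambda>(r, s). (\<lambda>i\<in>{1..a}. r i + t, \<lambda>j\<in>{1..b}. s j + t))"

lemma R23_index_eq:
  assumes "even a"
  shows "R23_index a b = {p \<in> theta_index a b. index_weight a b p = 0}"
  using assms by (auto simp: R23_index_def theta_index_def index_weight_def elim!: evenE)

lemma theta_powers_product:
  assumes "Im \<tau> > 0" "even a"
  shows "jacobi_theta2 (w + x) \<tau> ^ a * jacobi_theta3 (w + y) \<tau> ^ b =
      (\<Sum>\<^sub>\<infinity>p\<in>theta_index a b. qpow \<tau> (real a / 4) * R23_term a b x y \<tau> p *
         exp (2 * of_int (index_weight a b p) * \<i> * w))" (is "?lhs = infsum ?T _")
    and "(\<lambda>p. qpow \<tau> (real a / 4) * R23_term a b x y \<tau> p *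
         exp (2 * of_int (index_weight a b p) * \<i> * w)) summable_on theta_index a b"
proof -
  note 2 = jacobi_theta2_power[OF assms(1), where w = "w + x" and a = a]
  note 3 = jacobi_theta3_power[OF assms(1), where w = "w + y" and b = b]
  \<comment> \<open>Lets the simplifier match the \<open>a\<close> in the exponents with the
    \<open>a div 2\<close> in the weight.\<close>
  have a: "complex_of_nat a = 2 * of_nat (a div 2)"
    using assms(2) by (metis dvd_mult_div_cancel of_nat_mult of_nat_numeral)
  note summable = abs_summable_on_Times[OF 2(2) 3(2)]
  have T: "?T = (\<lambda>(r, s). exp (of_real pi * \<i> * \<tau> * (of_nat a / 4 + of_int ((\<Sum>i=1..a. (r i)\<^sup>2) + (\<Sum>i=1..a. r i)))
      + (2 * of_int (\<Sum>i=1..a. r i) + of_nat a) * \<i> * (w + x)) *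
      exp (of_real pi * \<i> * \<tau> * of_int (\<Sum>j=1..b. (s j)\<^sup>2)
      + 2 * of_int (\<Sum>j=1..b. s j) * \<i> * (w + y)))"
    by (simp add: fun_eq_iff R23_term_def index_weight_def qpow_def a algebra_simps
        del: of_int_sum of_nat_sum flip: exp_add)
  show "?T summable_on theta_index a b"
    unfolding T theta_index_def by (rule abs_summable_summable[OF summable])
  show "?lhs = infsum ?T (theta_index a b)"
    unfolding T theta_index_def 2(1) 3(1)
    by (rule infsum_Times[symmetric, OF abs_summable_summable[OF summable]])
qed

lemma index_shift_mem: "index_shift a b t p \<in> theta_index a b"
  by (auto simp: index_shift_def theta_index_def split: prod.splits)

lemma index_shift_shift:
  "p \<in> theta_index a b \<Longrightarrow> index_shift a b t (index_shift a b (- t) p) = p"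
  by (auto simp: index_shift_def theta_index_def fun_eq_iff PiE_def extensional_def split: prod.splits)

lemma index_weight_shift:
  "index_weight a b (index_shift a b t p) = index_weight a b p + int (a + b) * t"
  by (auto simp: index_shift_def index_weight_def sum.distrib algebra_simps split: prod.splits)

text \<open>Translation by \<open>t\<close> adds \<open>(a + b) * t^2 + 2 * t * N\<close> to the
  exponent of q, where the weight \<open>N\<close> is 0, and adds
  \<open>2 * t * (a * x + b * y) = 0\<close> to the linear part.\<close>

lemma R23_term_shift:
  assumes "even a" and "index_weight a b p = 0" and xy: "of_nat a * x + of_nat b * y = 0"
  shows "R23_term a b x y \<tau> (index_shift a b t p) =
    R23_term a b x y \<tau> p * qpow \<tau> (of_int (int (a + b) * t\<^sup>2))"
proof -
  obtain r s where p: "p = (r, s)" by (cases p)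
  define A B C D where "A = (\<Sum>i=1..a. r i)" and "B = (\<Sum>j=1..b. s j)"
    and "C = (\<Sum>i=1..a. (r i)\<^sup>2)" and "D = (\<Sum>j=1..b. (s j)\<^sup>2)"
  have zero: "2 * A + 2 * B + int a = 0"
    using assms(1,2) by (auto simp: p index_weight_def A_def B_def elim!: evenE)
  have "C + 2 * t * A + int a * t\<^sup>2 + (D + 2 * t * B + int b * t\<^sup>2) + (A + int a * t)
      = C + D + A + int (a + b) * t\<^sup>2 + t * (2 * A + 2 * B + int a)"
    by (simp add: algebra_simps)
  then have q: "C + 2 * t * A + int a * t\<^sup>2 + (D + 2 * t * B + int b * t\<^sup>2) + (A + int a * t)
      = C + D + A + int (a + b) * t\<^sup>2"
    by (simp only: zero mult_zero_right add_0_right)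
  have "2 * of_int (A + int a * t) * x + 2 * of_int (B + int b * t) * y + of_nat a * x
      = 2 * of_int A * x + 2 * of_int B * y + of_nat a * x + 2 * of_int t * (of_nat a * x + of_nat b * y)"
    by (simp add: algebra_simps)
  then have e: "2 * of_int (A + int a * t) * x + 2 * of_int (B + int b * t) * y + of_nat a * x
      = 2 * of_int A * x + 2 * of_int B * y + of_nat a * x"
    by (simp only: xy mult_zero_right add_0_right)
  have sums: "(\<Sum>i=1..a. r i + t) = A + int a * t" "(\<Sum>j=1..b. s j + t) = B + int b * t"
    "(\<Sum>i=1..a. (r i + t)\<^sup>2) = C + 2 * t * A + int a * t\<^sup>2"
    "(\<Sum>j=1..b. (s j + t)\<^sup>2) = D + 2 * t * B + int b * t\<^sup>2"
    by (simp_all add: A_def B_def C_def D_def power2_sum sum.distrib sum_distrib_left mult_ac)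
  have "R23_term a b x y \<tau> (index_shift a b t p) =
      qpow \<tau> (of_int (C + D + A + int (a + b) * t\<^sup>2)) *
      exp (\<i> * (2 * of_int A * x + 2 * of_int B * y + of_nat a * x))"
    unfolding R23_term_def index_shift_def p prod.case e[symmetric] q[symmetric] sums[symmetric]
    \<comment> \<open>The congruence rule supplies the range of the index, which is needed to
      evaluate the restricted abstractions.\<close>
    by (simp cong: sum.cong_simp)
  also have "\<dots> = R23_term a b x y \<tau> p * qpow \<tau> (of_int (int (a + b) * t\<^sup>2))"
    unfolding R23_term_def p prod.case A_def[symmetric] B_def[symmetric] C_def[symmetric] D_def[symmetric]
    by (simp add: qpow_def algebra_simps flip: exp_add)
  finally show ?thesis .
qed

text \<open>Translating all \<open>n\<close> entries by \<open>m * l\<close> raises the weight by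
  \<open>m * n * l\<close>. Hence \<open>l\<close> is recovered as the weight divided by
  \<open>m * n\<close>, and translating back by \<open>m * l\<close> returns to weight 0.\<close>

lemma bij_betw_index_shift:
  assumes "even a" "m > 0" "n > 0" "a + b = n"
  shows "bij_betw (\<lambda>(p, l). index_shift a b (int m * l) p) (R23_index a b \<times> UNIV)
    {p \<in> theta_index a b. int (m * n) dvd index_weight a b p}"
proof (rule bij_betw_byWitness[where f' = "\<lambda>p. let l = index_weight a b p div int (m * n)
    in (index_shift a b (- (int m * l)) p, l)"])
  have weight: "index_weight a b (index_shift a b (int m * l) p) = index_weight a b p + int (m * n) * l"
    "index_weight a b (index_shift a b (- (int m * l)) p) = index_weight a b p - int (m * n) * l" for l p
    by (simp_all add: index_weight_shift assms(4))
  have inv: "index_shift a b (- t) (index_shift a b t p) = p" if "p \<in> theta_index a b" for t p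
    using index_shift_shift[OF that, of "- t"] by simp
  have M: "int (m * n) \<noteq> 0" using assms by simp
  note simps = R23_index_eq[OF assms(1)] weight Let_def
  show "\<forall>u\<in>R23_index a b \<times> UNIV. (\<lambda>p. let l = index_weight a b p div int (m * n)
      in (index_shift a b (- (int m * l)) p, l)) ((\<lambda>(p, l). index_shift a b (int m * l) p) u) = u"
    using M by (auto simp: simps inv simp del: of_nat_mult)
  show "\<forall>p\<in>{p \<in> theta_index a b. int (m * n) dvd index_weight a b p}.
      (\<lambda>(p, l). index_shift a b (int m * l) p) (let l = index_weight a b p div int (m * n)
      in (index_shift a b (- (int m * l)) p, l)) = p"
    by (auto simp: Let_def index_shift_shift)
  show "(\<lambda>(p, l). index_shift a b (int m * l) p) ` (R23_index a b \<times> UNIV)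
      \<subseteq> {p \<in> theta_index a b. int (m * n) dvd index_weight a b p}"
    unfolding simps using index_shift_mem by (force simp: weight simp del: of_nat_mult)
  show "(\<lambda>p. let l = index_weight a b p div int (m * n) in (index_shift a b (- (int m * l)) p, l)) `
      {p \<in> theta_index a b. int (m * n) dvd index_weight a b p} \<subseteq> R23_index a b \<times> UNIV"
    unfolding simps using index_shift_mem by (force simp: weight simp del: of_nat_mult)
qed

section \<open>Summation over k and factorisation over translation classes\<close>

theorem theorem3p12:
  fixes m n a b :: nat and x y z \<tau> :: complex
  assumes "Im \<tau> > 0"
    and "m > 0" and "n > 0"
    and "a + b = n" and "even a"
    and "of_nat a * x + of_nat b * y = 0"
  shows "(\<Sum>k<m * n.
            jacobi_theta2 (z + x + of_nat k * of_real pi / of_nat (m * n)) \<tau> ^ a *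
            jacobi_theta3 (z + y + of_nat k * of_real pi / of_nat (m * n)) \<tau> ^ b)
         = R23 a b x y m n \<tau> * jacobi_theta3 (of_nat (m * n) * z) (of_nat (m\<^sup>2 * n) * \<tau>)"
proof -
  define M where "M = m * n"
  define N where "N = index_weight a b"
  define P where "P = theta_index a b"
  \<comment> \<open>The offsets \<open>x\<close> and \<open>y\<close> sit in
    \<open>R23_term\<close>; the common argument \<open>w\<close>, later \<open>z + u k\<close>,
    enters only through the weight.\<close>
  define G where "G = (\<lambda>w p. qpow \<tau> (real a / 4) * R23_term a b x y \<tau> p *
    exp (2 * of_int (N p) * \<i> * w))"
  define u where "u = (\<lambda>k. of_nat k * complex_of_real pi / of_nat M)"
  define L where "L = (\<lambda>l::int. qpow (of_nat (m\<^sup>2 * n) * \<tau>) (of_int (l\<^sup>2)) *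
    exp (of_int (2 * l) * \<i> * (of_nat M * z)))"
  define c where "c = of_nat M * qpow \<tau> (real a / 4)"
  have M: "M > 0" using assms by (simp add: M_def)
  have prod: "jacobi_theta2 (w + x) \<tau> ^ a * jacobi_theta3 (w + y) \<tau> ^ b = infsum (G w) P"
    and summable: "G w summable_on P" for w
    unfolding G_def P_def N_def using theta_powers_product[OF assms(1,5)] by auto
  have roots: "(\<Sum>k<M. G (z + u k) p) = (if int M dvd N p then of_nat M * G z p else 0)" for p
  proof -
    have "(\<Sum>k<M. G (z + u k) p) = G z p * (\<Sum>k<M. exp (2 * of_int (N p) * \<i> * u k))"
      by (simp add: G_def sum_distrib_left distrib_left exp_add mult.assoc)
    then show ?thesis
      unfolding u_def sum_roots_of_unity_powers[OF M] by simp
  qed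
  \<comment> \<open>Separation of variables: \<open>p\<close> carries the summand of
    \<open>R23\<close>, and \<open>l\<close> carries the summand of theta 3.\<close>
  have shift: "of_nat M * G z (index_shift a b (int m * l) p) = c * R23_term a b x y \<tau> p * L l"
    if "p \<in> R23_index a b" for p l
  proof -
    have wt: "index_weight a b p = 0" using that assms(5) by (simp add: R23_index_eq)
    \<comment> \<open>The factor \<open>m^2 * n\<close> may pass from the exponent to
      \<open>\<tau>\<close> because \<open>qpow\<close> depends only on their product.\<close>
    have "qpow \<tau> (of_int (int (a + b) * (int m * l)\<^sup>2)) = qpow (of_nat (m\<^sup>2 * n) * \<tau>) (of_int (l\<^sup>2))"
      by (simp add: qpow_def assms(4) power_mult_distrib mult_ac)
    then show ?thesis
      by (simp add: G_def N_def R23_term_shift[OF assms(5) wt assms(6)] index_weight_shift wt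
          L_def c_def M_def assms(4) mult_ac)
  qed
  note bij = bij_betw_index_shift[OF assms(5,2-4), folded M_def N_def P_def]
  \<comment> \<open>Summability passes to the surviving terms and then through the bijection, which
    justifies factoring the double sum.\<close>
  have "(\<lambda>p. of_nat M * G z p) summable_on {p \<in> P. int M dvd N p}"
    by (rule summable_on_subset_banach[OF summable_on_cmult_right[OF summable]]) auto
  then have "(\<lambda>(p, l). of_nat M * G z (index_shift a b (int m * l) p)) summable_on R23_index a b \<times> UNIV"
    using summable_on_reindex_bij_betw[OF bij, of "\<lambda>p. of_nat M * G z p"] by (simp add: case_prod_unfold)
  then have sumRL: "(\<lambda>(p, l). c * R23_term a b x y \<tau> p * L l) summable_on R23_index a b \<times> UNIV"
    by (rule summable_on_cong[THEN iffD1, rotated]) (auto simp: shift)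
  have "(\<Sum>k<M. jacobi_theta2 (z + x + u k) \<tau> ^ a * jacobi_theta3 (z + y + u k) \<tau> ^ b)
      = (\<Sum>k<M. infsum (G (z + u k)) P)"
    unfolding prod[symmetric] by (simp add: add_ac)
  \<comment> \<open>Exchanging the finite sum over \<open>k\<close> with the multiple series lets
    \<open>roots\<close> act term by term.\<close>
  also have "\<dots> = (\<Sum>\<^sub>\<infinity>p\<in>P. \<Sum>k<M. G (z + u k) p)"
    using summable by (intro infsumI[symmetric] has_sum_sum) auto
  also have "\<dots> = (\<Sum>\<^sub>\<infinity>p\<in>{p \<in> P. int M dvd N p}. of_nat M * G z p)"
    unfolding roots by (rule infsum_cong_neutral) auto
  also have "\<dots> = (\<Sum>\<^sub>\<infinity>(p, l)\<in>R23_index a b \<times> UNIV. of_nat M * G z (index_shift a b (int m * l) p))"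
    using infsum_reindex_bij_betw[OF bij, of "\<lambda>p. of_nat M * G z p"] by (simp add: case_prod_unfold)
  also have "\<dots> = (\<Sum>\<^sub>\<infinity>(p, l)\<in>R23_index a b \<times> UNIV. c * R23_term a b x y \<tau> p * L l)"
    by (rule infsum_cong) (auto simp: shift)
  also have "\<dots> = (\<Sum>\<^sub>\<infinity>p\<in>R23_index a b. c * R23_term a b x y \<tau> p) * infsum L UNIV"
    by (rule infsum_Times[OF sumRL])
  also have "(\<Sum>\<^sub>\<infinity>p\<in>R23_index a b. c * R23_term a b x y \<tau> p) = R23 a b x y m n \<tau>"
    unfolding infsum_cmult_right' by (simp add: c_def R23_def R23_term_def M_def)
  also have "infsum L UNIV = jacobi_theta3 (of_nat (m * n) * z) (of_nat (m\<^sup>2 * n) * \<tau>)"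
    by (simp add: L_def jacobi_theta3_def M_def)
  finally show ?thesis
    unfolding u_def M_def .
qed

end
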